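(* Let $G$ be a connected $k$-regular graph on $n$ vertices, and let $\lambda$ be the second largest eigenvalue in absolute value of the adjacency matrix of $G$. Then $$\mathrm{box}(G)\ge\left(\frac{k^2/\lambda^2}{\log\left(\frac{k^2}{\lambda^2}+1\right)}\right)\left(\frac{n-k-1}{2n}\right).$$
   Context: The boxicity $\mathrm{box}(G)$ is the minimum $k$ such that there are interval graphs $I_1,\dots,I_k$ on $V(G)$ with $E(G)=E(I_1)\cap\cdots\cap E(I_k)$. $\log$ is the natural logarithm. *)

theory Defs
  imports
    Complex_Main
    "Graph_Theory.Graph_Theory"
    "Jordan_Normal_Form.Char_Poly"
begin

text \<open>
  A finite simple graph is a \<^locale>\<open>pair_graph\<close>: every undirected edge is represented by
  both of its orientations.
\<close>

text \<open>
  For finite graphs, closed intervals yield the same class of graphs as arbitrary intervals.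
\<close>

definition interval_graph :: "'a pair_pre_digraph \<Rightarrow> bool" where
  "interval_graph H \<longleftrightarrow> pair_graph H \<and>
     (\<exists>l r :: 'a \<Rightarrow> real.
        (\<forall>v\<in>pverts H. l v \<le> r v) \<and>
        (\<forall>u\<in>pverts H. \<forall>v\<in>pverts H. u \<noteq> v \<longrightarrow>
           ((u, v) \<in> parcs H \<longleftrightarrow> {l u..r u} \<inter> {l v..r v} \<noteq> {})))"

text \<open>
  The intersection is taken inside the edge set of the complete graph on the vertices of \<open>G\<close>,
  so that the empty intersection (\<open>k = 0\<close>) represents exactly the complete graphs.
\<close>

definition interval_representation ::
    "'a pair_pre_digraph \<Rightarrow> nat \<Rightarrow> (nat \<Rightarrow> 'a pair_pre_digraph) \<Rightarrow> bool" where
  "interval_representation G k I \<longleftrightarrow>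
     (\<forall>i<k. interval_graph (I i) \<and> pverts (I i) = pverts G) \<and>
     parcs G = {(u, v). u \<in> pverts G \<and> v \<in> pverts G \<and> u \<noteq> v} \<inter> (\<Inter>i<k. parcs (I i))"

definition boxicity :: "'a pair_pre_digraph \<Rightarrow> nat" where
  "boxicity G = (LEAST k. \<exists>I. interval_representation G k I)"

text \<open>
  The minimum is over a nonempty set: for each pair of non-adjacent vertices, the complete graph
  without that edge is an interval graph.
\<close>

lemma interval_representation_exists:
  assumes "pair_graph G"
  shows "\<exists>k I. interval_representation G k I"
proof -
  interpret pair_graph G by fact
  define K where "K = {(u, v). u \<in> pverts G \<and> v \<in> pverts G \<and> u \<noteq> v}"
  have sub: "parcs G \<subseteq> K"
    unfolding K_def using wellformed' pair_no_loops by fastforce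
  have symG: "(b, a) \<in> parcs G" if "(a, b) \<in> parcs G" for a b
    using pair_sym_arcs that by (auto simp: symmetric_def sym_def)
  have finK: "finite K"
    by (rule finite_subset[of _ "pverts G \<times> pverts G"]) (auto simp: K_def pair_finite_verts)
  then obtain n and f :: "nat \<Rightarrow> 'a \<times> 'a" where f: "K - parcs G = f ` {i. i < n}"
    using finite_imp_nat_seg_image_inj_on[of "K - parcs G"] by auto
  define I where "I i = \<lparr>pverts = pverts G, parcs = K - {f i, prod.swap (f i)}\<rparr>" for i
  have int: "interval_graph (I i)" if "i < n" for i
  proof -
    obtain a b where ab: "f i = (a, b)" by fastforce
    have "f i \<in> K" using f that by auto
    hence abK: "a \<in> pverts G" "b \<in> pverts G" "a \<noteq> b" using ab by (auto simp: K_def)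
    have pg: "pair_graph (I i)"
      by unfold_locales
        (auto simp: I_def K_def ab symmetric_def sym_def pair_finite_verts
          intro!: finite_subset[OF _ finK])
    define l r :: "'a \<Rightarrow> real" where "l v = (if v = b then 2 else 0)"
      and "r v = (if v = a then 0 else 2)" for v
    have "\<forall>v\<in>pverts (I i). l v \<le> r v" using abK by (auto simp: l_def r_def)
    moreover have "\<forall>u\<in>pverts (I i). \<forall>v\<in>pverts (I i). u \<noteq> v \<longrightarrow>
        ((u, v) \<in> parcs (I i) \<longleftrightarrow> {l u..r u} \<inter> {l v..r v} \<noteq> {})"
      using abK by (auto simp: I_def K_def ab l_def r_def)
    ultimately show ?thesis using pg unfolding interval_graph_def by blast
  qed
  have "parcs G = K \<inter> (\<Inter>i<n. parcs (I i))"
  proof (intro subset_antisym subsetI)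
    fix e assume e: "e \<in> parcs G"
    have "e \<in> parcs (I i)" if "i < n" for i
    proof -
      have "f i \<notin> parcs G" using f that by auto
      moreover from this have "prod.swap (f i) \<notin> parcs G"
        using symG by (cases "f i") auto
      ultimately show ?thesis using e sub by (auto simp: I_def)
    qed
    thus "e \<in> K \<inter> (\<Inter>i<n. parcs (I i))" using e sub by auto
  next
    fix e assume e: "e \<in> K \<inter> (\<Inter>i<n. parcs (I i))"
    show "e \<in> parcs G"
    proof (rule ccontr)
      assume "e \<notin> parcs G"
      hence "e \<in> f ` {i. i < n}" using e f by blast
      then obtain i where "i < n" "e = f i" by blast
      moreover from this have "e \<in> parcs (I i)" using e by blast
      ultimately show False by (simp add: I_def)
    qed
  qed
  hence "interval_representation G n I"
    unfolding interval_representation_def K_def[symmetric] using int by (auto simp: I_def)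
  thus ?thesis by blast
qed

definition regular_graph :: "nat \<Rightarrow> 'a pair_pre_digraph \<Rightarrow> bool" where
  "regular_graph k G \<longleftrightarrow> (\<forall>v\<in>pverts G. out_degree (with_proj G) v = k)"

text \<open>The list \<open>vs\<close> enumerates the vertices, without repetition.\<close>

definition adjacency_matrix :: "'a list \<Rightarrow> 'a pair_pre_digraph \<Rightarrow> real mat" where
  "adjacency_matrix vs G =
     mat (length vs) (length vs) (\<lambda>(i, j). if (vs ! i, vs ! j) \<in> parcs G then 1 else 0)"

text \<open>
  The eigenvalues are listed with (algebraic) multiplicity; for a symmetric matrix all of them are
  real, so \<open>es\<close> has as many entries as the matrix has rows. In particular, a \<open>k\<close>-regular bipartite
  graph with an edge has a second eigenvalue of absolute value \<open>k\<close>.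
\<close>

definition second_largest_abs_eigenvalue :: "real mat \<Rightarrow> real \<Rightarrow> bool" where
  "second_largest_abs_eigenvalue A \<mu> \<longleftrightarrow>
     (\<exists>es. mset es = proots (char_poly A) \<and> sorted_wrt (\<lambda>x y. \<bar>x\<bar> \<ge> \<bar>y\<bar>) es \<and>
           2 \<le> length es \<and> \<mu> = es ! 1)"

end

theory Submission
  imports Defs "HOL-Analysis.Function_Topology"
begin

text \<open>
  Write \<open>x = k\<^sup>2 / \<mu>\<^sup>2\<close>. On the functions with sum zero the adjacency operator has norm at
  most \<open>\<bar>\<mu>\<bar>\<close>. Applied to \<open>1\<^sub>B - |B| / n\<close>, this gives \<open>x |A| |B| \<le> n (n - |B|)\<close>, that is
  \<open>|B| \<le> n\<^sup>2 / (n + x |A|)\<close>, whenever no edge joins \<open>A\<close> to \<open>B\<close>. In an interval supergraph of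
  \<open>G\<close>, take for \<open>A\<close> the \<open>i\<close> vertices with the smallest right endpoints and for \<open>B\<close> the
  intervals lying completely to the right of \<open>A\<close>. Summing over \<open>i\<close>, the supergraph misses at most
  \<open>n\<^sup>2 ln (1 + x) / x\<close> edges, while the interval graphs together have to miss all
  \<open>n (n - k - 1) / 2\<close> non-edges of \<open>G\<close>.
\<close>

section \<open>The adjacency operator of a connected regular graph\<close>

text \<open>First-order optimality: near \<open>t = 0\<close> the linear term dominates, so a
  nonzero \<open>b\<close> would make the expression negative for a small \<open>t\<close> of sign
  opposite to \<open>b\<close>.\<close>

lemma quadratic_nonneg_linear_coeff_zero:
  fixes b c :: real
  assumes "\<And>t. 0 \<le> 2 * t * b + t\<^sup>2 * c"
  shows "b = 0"
proof (rule ccontr)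
  assume b: "b \<noteq> 0"
  \<comment> \<open>With this \<open>s\<close> the quadratic term at \<open>t = - s * b\<close> is
    too small to outweigh the linear one.\<close>
  define s where "s = 1 / (\<bar>c\<bar> + 1)"
  have s: "s > 0" "s * \<bar>c\<bar> < 1" by (auto simp: s_def field_simps)
  have "s * c < 2"
    using s mult_left_mono[of c "\<bar>c\<bar>" s] by linarith
  have "0 \<le> 2 * (- s * b) * b + (- s * b)\<^sup>2 * c" by (rule assms)
  hence "0 \<le> (s * b\<^sup>2) * (s * c - 2)" by (simp add: power2_eq_square algebra_simps)
  moreover have "0 < s * b\<^sup>2" using s b by simp
  ultimately have "0 \<le> s * c - 2" by (simp add: zero_le_mult_iff)
  with \<open>s * c < 2\<close> show False by simp
qed

text \<open>Connectedness is stated through sets closed under taking neighbours, the form that a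
  maximum principle needs; no walks occur.\<close>

locale connected_regular =
  fixes V :: "'a set" and E :: "('a \<times> 'a) set" and k :: nat
  assumes finite_V: "finite V"
    and nonempty_V: "V \<noteq> {}"
    and E_subset: "E \<subseteq> V \<times> V"
    and sym_E: "sym E"
    and card_neighbours: "v \<in> V \<Longrightarrow> card (E `` {v}) = k"
    and connected: "S \<subseteq> V \<Longrightarrow> S \<noteq> {} \<Longrightarrow> E `` S \<subseteq> S \<Longrightarrow> S = V"
begin

definition adj :: "('a \<Rightarrow> real) \<Rightarrow> 'a \<Rightarrow> real" where
  "adj g v = (\<Sum>u\<in>E `` {v}. g u)"

lemma neighbours_subset: "E `` {v} \<subseteq> V"
  using E_subset by auto

lemma finite_neighbours: "finite (E `` {v})"
  using finite_subset[OF neighbours_subset finite_V] .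

lemma card_V_pos: "0 < card V"
  using finite_V nonempty_V by (simp add: card_gt_0_iff)

lemma adj_alt: "adj g v = (\<Sum>u\<in>V. of_bool ((v, u) \<in> E) * g u)"
proof -
  have "adj g v = (\<Sum>u\<in>E `` {v}. of_bool ((v, u) \<in> E) * g u)"
    unfolding adj_def by (intro sum.cong) auto
  also have "\<dots> = (\<Sum>u\<in>V. of_bool ((v, u) \<in> E) * g u)"
    using finite_V neighbours_subset by (intro sum.mono_neutral_left) auto
  finally show ?thesis .
qed

lemma adj_cong: "(\<And>u. u \<in> V \<Longrightarrow> f u = g u) \<Longrightarrow> adj f v = adj g v"
  unfolding adj_alt by (intro sum.cong) auto

lemma adj_add: "adj (\<lambda>v. f v + g v) v = adj f v + adj g v"
  by (simp add: adj_def sum.distrib)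

lemma adj_diff: "adj (\<lambda>v. f v - g v) v = adj f v - adj g v"
  by (simp add: adj_def sum_subtractf)

lemma adj_scale: "adj (\<lambda>v. c * g v) v = c * adj g v"
  by (simp add: adj_def sum_distrib_left)

lemma adj_const: "v \<in> V \<Longrightarrow> adj (\<lambda>_. c) v = real k * c"
  by (simp add: adj_def card_neighbours)

lemma adj_self_adjoint: "(\<Sum>v\<in>V. adj f v * g v) = (\<Sum>v\<in>V. f v * adj g v)"
proof -
  have swap: "(v, u) \<in> E \<longleftrightarrow> (u, v) \<in> E" for u v
    using sym_E by (auto dest: symD)
  have "(\<Sum>v\<in>V. adj f v * g v) = (\<Sum>v\<in>V. \<Sum>u\<in>V. of_bool ((v, u) \<in> E) * f u * g v)"
    by (simp add: adj_alt sum_distrib_right)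
  also have "\<dots> = (\<Sum>u\<in>V. \<Sum>v\<in>V. of_bool ((v, u) \<in> E) * f u * g v)"
    by (rule sum.swap)
  also have "\<dots> = (\<Sum>u\<in>V. \<Sum>v\<in>V. f u * (of_bool ((u, v) \<in> E) * g v))"
    by (intro sum.cong refl) (simp add: swap)
  also have "\<dots> = (\<Sum>v\<in>V. f v * adj g v)"
    by (simp add: adj_alt sum_distrib_left)
  finally show ?thesis .
qed

lemma sum_adj: "(\<Sum>v\<in>V. adj g v) = real k * (\<Sum>v\<in>V. g v)"
  using adj_self_adjoint[of g "\<lambda>_. 1"] by (simp add: adj_const sum_distrib_left mult.commute)

section \<open>Eigenvalues are at most \<open>k\<close> in absolute value, and \<open>k\<close> is
  simple\<close>

text \<open>At a vertex where \<open>\<bar>h v\<bar>\<close> is maximal, the eigenvalue equation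
  expresses \<open>e * h v\<close> as a sum of \<open>k\<close> terms, none of them larger in
  absolute value.\<close>

lemma eigenvalue_abs_le_degree:
  assumes eig: "\<And>v. v \<in> V \<Longrightarrow> adj h v = e * h v" and nz: "\<exists>v\<in>V. h v \<noteq> 0"
  shows "\<bar>e\<bar> \<le> real k"
proof -
  define M where "M = Max ((\<lambda>v. \<bar>h v\<bar>) ` V)"
  have le: "\<bar>h v\<bar> \<le> M" if "v \<in> V" for v
    unfolding M_def using finite_V that by auto
  have "M \<in> (\<lambda>v. \<bar>h v\<bar>) ` V"
    unfolding M_def using finite_V nonempty_V by (intro Max_in) auto
  then obtain v where v: "v \<in> V" "\<bar>h v\<bar> = M" by auto
  have pos: "M > 0" using nz le by force
  have "\<bar>e\<bar> * M = \<bar>adj h v\<bar>" using eig v by (simp add: abs_mult)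
  also have "\<dots> \<le> (\<Sum>u\<in>E `` {v}. \<bar>h u\<bar>)" unfolding adj_def by (rule sum_abs)
  also have "\<dots> \<le> (\<Sum>u\<in>E `` {v}. M)" using neighbours_subset le by (intro sum_mono) blast
  also have "\<dots> = real k * M" using v by (simp add: card_neighbours)
  finally show ?thesis using pos by simp
qed

text \<open>Maximum principle: if \<open>h\<close> equals its average over the neighbours, the set
  \<open>S\<close> of maximum points is closed under neighbours. Connectedness makes
  \<open>h\<close> constant, and the sum makes the constant zero.\<close>

lemma eigenfunction_degree_zero:
  assumes eig: "\<And>v. v \<in> V \<Longrightarrow> adj h v = real k * h v" and sum0: "(\<Sum>v\<in>V. h v) = 0"
    and v: "v \<in> V"
  shows "h v = 0"
proof -
  define M where "M = Max (h ` V)"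
  define S where "S = {v\<in>V. h v = M}"
  have le: "h v \<le> M" if "v \<in> V" for v
    unfolding M_def using finite_V that by auto
  have "M \<in> h ` V"
    unfolding M_def using finite_V nonempty_V by (intro Max_in) auto
  hence "S \<noteq> {}" by (auto simp: S_def)
  moreover have "E `` S \<subseteq> S"
  proof
    fix u assume "u \<in> E `` S"
    then obtain w where w: "w \<in> V" "h w = M" "u \<in> E `` {w}" by (auto simp: S_def)
    \<comment> \<open>Both parts of the sum equal \<open>k * M\<close>; as no summand is negative,
      each one vanishes.\<close>
    have "(\<Sum>z\<in>E `` {w}. M - h z) = 0"
      using eig[OF w(1)] w by (simp add: sum_subtractf card_neighbours adj_def)
    moreover have "\<forall>z\<in>E `` {w}. 0 \<le> M - h z" using le neighbours_subset by force
    ultimately have "M - h u = 0"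
      using w(3) sum_nonneg_eq_0_iff[OF finite_neighbours, of w "\<lambda>z. M - h z"] by blast
    thus "u \<in> S" using w(3) neighbours_subset by (auto simp: S_def)
  qed
  ultimately have "S = V" by (intro connected) (auto simp: S_def)
  hence const: "h u = M" if "u \<in> V" for u using that by (auto simp: S_def)
  with sum0 have "real (card V) * M = 0" by simp
  thus ?thesis using card_V_pos const v by simp
qed

section \<open>The norm of the adjacency operator on functions of sum zero\<close>

text \<open>The values outside \<open>V\<close> are pinned to zero: otherwise the set would not be
  compact in the product topology on all functions.\<close>

definition unit_zero_sum :: "('a \<Rightarrow> real) set" where
  "unit_zero_sum = {g. (\<forall>v. v \<notin> V \<longrightarrow> g v = 0) \<and> (\<Sum>v\<in>V. (g v)\<^sup>2) = 1 \<and> (\<Sum>v\<in>V. g v) = 0}"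

text \<open>By Tychonoff the box \<open>P\<close> is compact, and the two equations cut out closed
  sets. The unit norm confines each coordinate to the interval from -1 to 1.\<close>

lemma compact_unit_zero_sum: "compact unit_zero_sum"
proof -
  define P where "P = (PiE UNIV (\<lambda>v. if v \<in> V then {-1..1::real} else {0}))"
  have "compactin (product_topology (\<lambda>_. euclidean) UNIV) P"
    unfolding P_def by (subst compactin_PiE) auto
  hence "compact P" by (simp add: euclidean_product_topology)
  moreover have "closed {g. (\<Sum>v\<in>V. (g v)\<^sup>2) = (1::real)}"
    by (intro closed_Collect_eq continuous_intros continuous_on_product_coordinates)
  moreover have "closed {g. (\<Sum>v\<in>V. g v) = (0::real)}"
    by (intro closed_Collect_eq continuous_intros continuous_on_product_coordinates)
  moreover have "unit_zero_sum = P \<inter> {g. (\<Sum>v\<in>V. (g v)\<^sup>2) = 1} \<inter> {g. (\<Sum>v\<in>V. g v) = 0}"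
  proof (intro subset_antisym subsetI)
    fix g assume g: "g \<in> unit_zero_sum"
    have "\<bar>g v\<bar> \<le> 1" if "v \<in> V" for v
    proof -
      have "(g v)\<^sup>2 \<le> (\<Sum>v\<in>V. (g v)\<^sup>2)"
        using finite_V that by (intro member_le_sum) auto
      thus ?thesis using g by (simp add: unit_zero_sum_def abs_square_le_1)
    qed
    hence "g v \<in> {-1..1}" if "v \<in> V" for v using that by (auto simp: abs_le_iff)
    thus "g \<in> P \<inter> {g. (\<Sum>v\<in>V. (g v)\<^sup>2) = 1} \<inter> {g. (\<Sum>v\<in>V. g v) = 0}"
      using g by (auto simp: unit_zero_sum_def P_def)
  next
    fix g assume g: "g \<in> P \<inter> {g. (\<Sum>v\<in>V. (g v)\<^sup>2) = 1} \<inter> {g. (\<Sum>v\<in>V. g v) = 0}"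
    hence "g v = 0" if "v \<notin> V" for v
      using PiE_mem[of g UNIV "\<lambda>v. if v \<in> V then {-1..1} else {0}" v] that by (simp add: P_def)
    thus "g \<in> unit_zero_sum" using g by (simp add: unit_zero_sum_def)
  qed
  ultimately show ?thesis by (simp add: compact_Int_closed)
qed

lemma unit_zero_sum_nonempty:
  assumes "2 \<le> card V"
  shows "unit_zero_sum \<noteq> {}"
proof -
  obtain a b where ab: "a \<in> V" "b \<in> V" "a \<noteq> b"
    using assms card_le_Suc0_iff_eq[OF finite_V] by fastforce
  define g where "g v = (if v = a then 1 / sqrt 2 else if v = b then - 1 / sqrt 2 else 0)" for v
  have "(\<Sum>v\<in>V. (g v)\<^sup>2) = (\<Sum>v\<in>{a, b}. (g v)\<^sup>2)"
    by (rule sum.mono_neutral_right) (use ab finite_V in \<open>auto simp: g_def\<close>)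
  moreover have "(\<Sum>v\<in>V. g v) = (\<Sum>v\<in>{a, b}. g v)"
    by (rule sum.mono_neutral_right) (use ab finite_V in \<open>auto simp: g_def\<close>)
  ultimately have "g \<in> unit_zero_sum" using ab by (auto simp: unit_zero_sum_def g_def power_divide)
  thus ?thesis by blast
qed

text \<open>
  The maximum \<open>m\<close> of \<open>\<parallel>adj g\<parallel>\<^sup>2\<close> makes \<open>m - adj\<^sup>2\<close> positive semidefinite on the functions of sum
  zero; a maximiser has energy zero, so it lies in the kernel.
\<close>

lemma adj_square_extremal:
  assumes "2 \<le> card V"
  obtains m f where "0 \<le> m" "f \<in> unit_zero_sum" "\<And>v. v \<in> V \<Longrightarrow> adj (adj f) v = m * f v"
    "\<And>g. (\<Sum>v\<in>V. g v) = 0 \<Longrightarrow> (\<Sum>v\<in>V. (adj g v)\<^sup>2) \<le> m * (\<Sum>v\<in>V. (g v)\<^sup>2)"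
proof -
  define Q where "Q g = (\<Sum>v\<in>V. (adj g v)\<^sup>2)" for g
  have "continuous_on unit_zero_sum Q"
    unfolding Q_def adj_def
    by (intro continuous_intros continuous_on_subset[OF continuous_on_product_coordinates]) auto
  then obtain f where f: "f \<in> unit_zero_sum" and fmax: "\<And>g. g \<in> unit_zero_sum \<Longrightarrow> Q g \<le> Q f"
    using continuous_attains_sup[OF compact_unit_zero_sum unit_zero_sum_nonempty[OF assms]] by blast
  define m where "m = Q f"
  have m0: "0 \<le> m" unfolding m_def Q_def by (intro sum_nonneg) auto
  have bound: "Q g \<le> m * (\<Sum>v\<in>V. (g v)\<^sup>2)" if g0: "(\<Sum>v\<in>V. g v) = 0" for g
  proof (cases "\<forall>v\<in>V. g v = 0")
    case True
    hence "adj g v = 0" for v using adj_cong[of g "\<lambda>_. 0" v] by (auto simp: adj_def)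
    thus ?thesis using True by (simp add: Q_def)
  next
    case False
    define s where "s = (\<Sum>v\<in>V. (g v)\<^sup>2)"
    have s: "s > 0" unfolding s_def using False finite_V by (auto intro: sum_pos2)
    \<comment> \<open>Normalising \<open>g\<close> and cutting it off outside \<open>V\<close>
      yields a competitor of \<open>f\<close>; \<open>adj\<close> does not see the cut-off.\<close>
    define g' where "g' v = (if v \<in> V then (1 / sqrt s) * g v else 0)" for v
    have "g' \<in> unit_zero_sum"
      using g0 s
      by (simp add: unit_zero_sum_def g'_def power_divide flip: sum_divide_distrib s_def)
    hence "Q g' \<le> m" using fmax by (simp add: m_def)
    moreover have "adj g' v = (1 / sqrt s) * adj g v" for v
      unfolding adj_scale[symmetric] by (intro adj_cong) (simp add: g'_def)
    hence "Q g' = Q g / s"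
      using s by (simp add: Q_def power_divide flip: sum_divide_distrib)
    ultimately show ?thesis using s by (simp add: s_def field_simps)
  qed
  have f0: "(\<Sum>v\<in>V. f v) = 0" and f1: "(\<Sum>v\<in>V. (f v)\<^sup>2) = 1"
    using f by (auto simp: unit_zero_sum_def)
  \<comment> \<open>Up to a factor 2, \<open>w\<close> is the gradient at \<open>f\<close> of the
    energy \<open>m * (\<Sum>v\<in>V. (g v)\<^sup>2) - Q g\<close>. Its sum is zero, so
    \<open>f + t * w\<close> stays within the scope of \<open>bound\<close>.\<close>
  define w where "w v = m * f v - adj (adj f) v" for v
  have w0: "(\<Sum>v\<in>V. w v) = 0"
    using f0 by (simp add: w_def sum_subtractf sum_adj flip: sum_distrib_left)
  define c where "c = m * (\<Sum>v\<in>V. (w v)\<^sup>2) - Q w"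
  \<comment> \<open>The energy of \<open>f + t * w\<close> is nonnegative and has no constant term,
    because \<open>f\<close> has energy zero. Its linear coefficient is the squared norm of
    \<open>w\<close>.\<close>
  have "(\<Sum>v\<in>V. (w v)\<^sup>2) = 0"
  proof (rule quadratic_nonneg_linear_coeff_zero)
    fix t :: real
    have "(\<Sum>v\<in>V. f v + t * w v) = 0"
      using f0 w0 by (simp add: sum.distrib flip: sum_distrib_left)
    hence "0 \<le> m * (\<Sum>v\<in>V. (f v + t * w v)\<^sup>2) - Q (\<lambda>v. f v + t * w v)"
      using bound by fastforce
    also have "(\<Sum>v\<in>V. (f v + t * w v)\<^sup>2) =
        1 + 2 * t * (\<Sum>v\<in>V. f v * w v) + t\<^sup>2 * (\<Sum>v\<in>V. (w v)\<^sup>2)"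
      unfolding f1[symmetric] sum_distrib_left sum.distrib[symmetric]
      by (intro sum.cong refl) (simp add: power2_eq_square algebra_simps)
    also have "Q (\<lambda>v. f v + t * w v) = m + 2 * t * (\<Sum>v\<in>V. adj f v * adj w v) + t\<^sup>2 * Q w"
      unfolding m_def Q_def sum_distrib_left sum.distrib[symmetric] adj_add adj_scale
      by (intro sum.cong refl) (simp add: power2_eq_square algebra_simps)
    also have "(\<Sum>v\<in>V. adj f v * adj w v) = (\<Sum>v\<in>V. adj (adj f) v * w v)"
      by (simp add: adj_self_adjoint)
    also have "m * (1 + 2 * t * (\<Sum>v\<in>V. f v * w v) + t\<^sup>2 * (\<Sum>v\<in>V. (w v)\<^sup>2))
          - (m + 2 * t * (\<Sum>v\<in>V. adj (adj f) v * w v) + t\<^sup>2 * Q w)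
        = 2 * t * (m * (\<Sum>v\<in>V. f v * w v) - (\<Sum>v\<in>V. adj (adj f) v * w v)) + t\<^sup>2 * c"
      by (simp add: c_def algebra_simps)
    also have "m * (\<Sum>v\<in>V. f v * w v) - (\<Sum>v\<in>V. adj (adj f) v * w v) = (\<Sum>v\<in>V. (w v)\<^sup>2)"
      unfolding sum_distrib_left sum_subtractf[symmetric]
      by (intro sum.cong refl) (simp add: w_def power2_eq_square algebra_simps)
    finally show "0 \<le> 2 * t * (\<Sum>v\<in>V. (w v)\<^sup>2) + t\<^sup>2 * c" .
  qed
  hence "w v = 0" if "v \<in> V" for v using that finite_V by (simp add: sum_nonneg_eq_0_iff)
  hence "adj (adj f) v = m * f v" if "v \<in> V" for v using that by (simp add: w_def)
  thus ?thesis using that m0 f bound by (simp add: Q_def)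
qed

text \<open>With \<open>r = sqrt m\<close>, the operator \<open>adj\<^sup>2 - m\<close> factors as
  \<open>(adj - r) (adj + r)\<close> and annihilates \<open>f\<close>. Either
  \<open>h = (adj + r) f\<close> is nonzero and has eigenvalue \<open>r\<close>, or \<open>f\<close>
  itself has eigenvalue \<open>- r\<close>.\<close>

lemma extremal_eigenfunction:
  assumes "2 \<le> card V"
  obtains e h where "(\<Sum>v\<in>V. h v) = 0" "\<exists>v\<in>V. h v \<noteq> 0" "\<And>v. v \<in> V \<Longrightarrow> adj h v = e * h v"
    "\<And>g. (\<Sum>v\<in>V. g v) = 0 \<Longrightarrow> (\<Sum>v\<in>V. (adj g v)\<^sup>2) \<le> e\<^sup>2 * (\<Sum>v\<in>V. (g v)\<^sup>2)"
proof -
  obtain m f where m0: "0 \<le> m" and f: "f \<in> unit_zero_sum"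
    and ff: "\<And>v. v \<in> V \<Longrightarrow> adj (adj f) v = m * f v"
    and bound: "\<And>g. (\<Sum>v\<in>V. g v) = 0 \<Longrightarrow> (\<Sum>v\<in>V. (adj g v)\<^sup>2) \<le> m * (\<Sum>v\<in>V. (g v)\<^sup>2)"
    using adj_square_extremal[OF assms] by metis
  define r where "r = sqrt m"
  have r: "m = r\<^sup>2" using m0 by (simp add: r_def)
  have f0: "(\<Sum>v\<in>V. f v) = 0" and f1: "(\<Sum>v\<in>V. (f v)\<^sup>2) = 1"
    using f by (auto simp: unit_zero_sum_def)
  have fnz: "\<exists>v\<in>V. f v \<noteq> 0"
  proof (rule ccontr)
    assume "\<not> (\<exists>v\<in>V. f v \<noteq> 0)"
    hence "(\<Sum>v\<in>V. (f v)\<^sup>2) = 0" by simp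
    with f1 show False by simp
  qed
  define h where "h v = adj f v + r * f v" for v
  show thesis
  proof (cases "\<exists>v\<in>V. h v \<noteq> 0")
    case True
    show thesis
    proof (rule that[of h r])
      show "(\<Sum>v\<in>V. h v) = 0"
        using f0 by (simp add: h_def sum.distrib sum_adj flip: sum_distrib_left)
      show "adj h v = r * h v" if "v \<in> V" for v
        using ff[OF that] unfolding h_def
        by (simp add: adj_add adj_scale r power2_eq_square algebra_simps)
    qed (use True bound r in auto)
  next
    case False
    show thesis
    proof (rule that[of f "- r"])
      show "adj f v = - r * f v" if "v \<in> V" for v
        using False that by (auto simp: h_def add_eq_0_iff)
    qed (use f0 fnz bound r in auto)
  qed
qed

section \<open>Passing to the eigenvalues of the adjacency matrix\<close>

lemma eigenvalue_adjacency_matrix: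
  assumes "distinct vs" "set vs = V" "parcs G = E"
    and eig: "\<And>v. v \<in> V \<Longrightarrow> adj h v = e * h v" and nz: "\<exists>v\<in>V. h v \<noteq> 0"
  shows "eigenvalue (adjacency_matrix vs G) e"
proof -
  define N where "N = length vs"
  define x where "x = vec N (\<lambda>i. h (vs ! i))"
  let ?A = "adjacency_matrix vs G"
  have "?A *\<^sub>v x = e \<cdot>\<^sub>v x"
  proof (rule eq_vecI)
    fix i assume "i < dim_vec (e \<cdot>\<^sub>v x)"
    hence i: "i < N" by (simp add: x_def)
    hence viV: "vs ! i \<in> V" using assms(2) by (auto simp: N_def)
    have "(?A *\<^sub>v x) $ i = (\<Sum>j\<in>{0..<N}. of_bool ((vs ! i, vs ! j) \<in> E) * h (vs ! j))"
      using i by (simp add: adjacency_matrix_def x_def scalar_prod_def N_def assms(3) of_bool_def)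
    also have "\<dots> = (\<Sum>u\<in>V. of_bool ((vs ! i, u) \<in> E) * h u)"
      using assms(1,2) by (intro sum.reindex_bij_betw bij_betw_nth) (auto simp: N_def)
    also have "\<dots> = e * h (vs ! i)" using eig[OF viV] by (simp add: adj_alt)
    finally show "(?A *\<^sub>v x) $ i = (e \<cdot>\<^sub>v x) $ i" using i by (simp add: x_def)
  qed (simp add: adjacency_matrix_def x_def N_def)
  moreover have "x \<noteq> 0\<^sub>v N"
  proof
    assume x0: "x = 0\<^sub>v N"
    obtain v where v: "v \<in> V" "h v \<noteq> 0" using nz by blast
    then obtain i where i: "i < N" "vs ! i = v"
      using assms(2) by (auto simp: in_set_conv_nth N_def)
    hence "x $ i = h v" by (simp add: x_def)
    with x0 i v show False by simp
  qed
  moreover have "x \<in> carrier_vec N" by (simp add: x_def)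
  moreover have "dim_row ?A = N" by (simp add: adjacency_matrix_def N_def)
  ultimately show ?thesis unfolding eigenvalue_def eigenvector_def by metis
qed

text \<open>The extremal eigenvalue \<open>e\<close> and the degree \<open>k\<close> are distinct
  eigenvalues, so they sit at different positions of \<open>es\<close> and at most one of them is at
  the head.\<close>

lemma adj_norm_le_second_eigenvalue:
  assumes vs: "distinct vs" "set vs = V" "parcs G = E"
    and second: "second_largest_abs_eigenvalue (adjacency_matrix vs G) \<mu>"
    and card: "2 \<le> card V" and g0: "(\<Sum>v\<in>V. g v) = 0"
  shows "(\<Sum>v\<in>V. (adj g v)\<^sup>2) \<le> \<mu>\<^sup>2 * (\<Sum>v\<in>V. (g v)\<^sup>2)"
proof -
  let ?A = "adjacency_matrix vs G"
  obtain e h where h0: "(\<Sum>v\<in>V. h v) = 0" and hnz: "\<exists>v\<in>V. h v \<noteq> 0"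
    and eig: "\<And>v. v \<in> V \<Longrightarrow> adj h v = e * h v"
    and bound: "\<And>g. (\<Sum>v\<in>V. g v) = 0 \<Longrightarrow> (\<Sum>v\<in>V. (adj g v)\<^sup>2) \<le> e\<^sup>2 * (\<Sum>v\<in>V. (g v)\<^sup>2)"
    using extremal_eigenfunction[OF card] by metis
  have ne: "e \<noteq> real k" using eigenfunction_degree_zero[of h] eig h0 hnz by blast
  have le: "\<bar>e\<bar> \<le> real k" using eigenvalue_abs_le_degree eig hnz by blast
  obtain es where es: "mset es = proots (char_poly ?A)"
    "sorted_wrt (\<lambda>x y. \<bar>x\<bar> \<ge> \<bar>y\<bar>) es" "2 \<le> length es" "\<mu> = es ! 1"
    using second unfolding second_largest_abs_eigenvalue_def by blast
  have carr: "?A \<in> carrier_mat (length vs) (length vs)" by (simp add: adjacency_matrix_def)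
  have cp0: "char_poly ?A \<noteq> 0" using degree_monic_char_poly[OF carr] by force
  have in_es: "c \<in> set es" if "eigenvalue ?A c" for c
  proof -
    have "c \<in># proots (char_poly ?A)"
      using that cp0 by (simp add: eigenvalue_root_char_poly[OF carr])
    thus ?thesis by (simp flip: es(1))
  qed
  have "eigenvalue ?A e" using eigenvalue_adjacency_matrix[OF vs] eig hnz by blast
  moreover have "eigenvalue ?A (real k)"
    using nonempty_V by (intro eigenvalue_adjacency_matrix[OF vs, of "\<lambda>_. 1"]) (auto simp: adj_const)
  ultimately obtain i j where ij: "i < length es" "es ! i = e" "j < length es" "es ! j = real k"
    using in_es by (metis in_set_conv_nth)
  have tail: "\<bar>es ! l\<bar> \<le> \<bar>\<mu>\<bar>" if "1 \<le> l" "l < length es" for l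
    using that es(2,4) by (cases "l = 1") (auto simp: sorted_wrt_iff_nth_less)
  have "i \<noteq> j" using ij ne by auto
  \<comment> \<open>If \<open>e\<close> is at the head, then \<open>k\<close> is in the tail and
    \<open>\<bar>e\<bar> \<le> k \<le> \<bar>\<mu>\<bar>\<close>; otherwise \<open>e\<close> is in
    the tail itself.\<close>
  hence "\<bar>e\<bar> \<le> \<bar>\<mu>\<bar>"
    using tail[of i] tail[of j] ij le by (cases "i = 0") auto
  hence "e\<^sup>2 \<le> \<mu>\<^sup>2" by (simp add: abs_le_square_iff)
  hence "e\<^sup>2 * (\<Sum>v\<in>V. (g v)\<^sup>2) \<le> \<mu>\<^sup>2 * (\<Sum>v\<in>V. (g v)\<^sup>2)"
    by (intro mult_right_mono sum_nonneg) auto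
  with bound[OF g0] show ?thesis by linarith
qed

section \<open>The spectral bound for two vertex sets without edges between them\<close>

text \<open>The centred indicator \<open>g\<close> of \<open>B\<close> has sum zero, and without
  edges to \<open>B\<close> its image under \<open>adj\<close> is the constant
  \<open>- k * b / n\<close> on \<open>A\<close>. The vertices of \<open>A\<close> alone then give a
  lower bound for the norm of the image.\<close>

lemma nonadjacent_sets_bound:
  assumes norm: "\<And>g. (\<Sum>v\<in>V. g v) = 0 \<Longrightarrow> (\<Sum>v\<in>V. (adj g v)\<^sup>2) \<le> \<mu>\<^sup>2 * (\<Sum>v\<in>V. (g v)\<^sup>2)"
    and A: "A \<subseteq> V" and B: "B \<subseteq> V" and noedge: "E \<inter> A \<times> B = {}"
  shows "real k ^ 2 * real (card A) * real (card B) \<le>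
    \<mu>\<^sup>2 * real (card V) * (real (card V) - real (card B))"
proof (cases "B = {}")
  case False
  define n where "n = real (card V)"
  define b where "b = real (card B)"
  have n: "n > 0" using card_V_pos by (simp add: n_def)
  have b: "b > 0" using False B finite_V by (auto simp: b_def card_gt_0_iff intro: finite_subset)
  define g where "g v = of_bool (v \<in> B) - b / n" for v
  have ind: "(\<Sum>v\<in>V. of_bool (v \<in> B)) = b"
    using B finite_V by (simp add: b_def Int_absorb1 flip: Int_def)
  have g0: "(\<Sum>v\<in>V. g v) = 0"
    using n by (simp add: g_def sum_subtractf ind flip: n_def)
  have "(\<Sum>v\<in>V. (g v)\<^sup>2) = (\<Sum>v\<in>V. (1 - 2 * b / n) * of_bool (v \<in> B) + (b / n)\<^sup>2)"
    by (intro sum.cong refl) (simp add: g_def power2_eq_square algebra_simps)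
  also have "\<dots> = (1 - 2 * b / n) * b + n * (b / n)\<^sup>2"
    by (simp only: sum.distrib ind sum_constant n_def flip: sum_distrib_left)
  also have "\<dots> = b * (n - b) / n" using n by (simp add: field_simps power2_eq_square)
  finally have norm_g: "(\<Sum>v\<in>V. (g v)\<^sup>2) = b * (n - b) / n" .
  have on_A: "adj g v = - (real k * b / n)" if "v \<in> A" for v
  proof -
    have "adj g v = adj (\<lambda>u. of_bool (u \<in> B)) v - adj (\<lambda>u. b / n) v"
      unfolding g_def by (rule adj_diff)
    also have "adj (\<lambda>u. of_bool (u \<in> B)) v = 0"
      unfolding adj_def using noedge that by (intro sum.neutral) auto
    finally show ?thesis using A that by (auto simp: adj_const)
  qed
  have "real (card A) * (real k * b / n)\<^sup>2 = (\<Sum>v\<in>A. (adj g v)\<^sup>2)" by (simp add: on_A)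
  also have "\<dots> \<le> (\<Sum>v\<in>V. (adj g v)\<^sup>2)" using A finite_V by (intro sum_mono2) auto
  also have "\<dots> \<le> \<mu>\<^sup>2 * (b * (n - b) / n)" using norm[OF g0] norm_g by simp
  \<comment> \<open>Both sides are arranged to show the common positive factor
    \<open>b / n\<^sup>2\<close>, which is cancelled next.\<close>
  finally have "(real k ^ 2 * real (card A) * b) * (b / n\<^sup>2) \<le> (\<mu>\<^sup>2 * n * (n - b)) * (b / n\<^sup>2)"
    using n by (simp add: power_divide power_mult_distrib power2_eq_square mult_ac)
  hence "real k ^ 2 * real (card A) * b \<le> \<mu>\<^sup>2 * n * (n - b)"
    by (rule mult_right_le_imp_le) (use b n in simp)
  thus ?thesis by (simp add: b_def n_def)
qed simp

end

section \<open>Counting the non-edges of an interval graph\<close>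

text \<open>Ties in \<open>r\<close> only increase the cardinalities on the left, hence the monotonicity.\<close>

lemma sum_rank_le:
  fixes r :: "'a \<Rightarrow> real" and F :: "nat \<Rightarrow> real"
  assumes "finite V" and F: "antimono F"
  shows "(\<Sum>u\<in>V. F (card {w\<in>V. r w \<le> r u})) \<le> (\<Sum>i<card V. F (Suc i))"
  using assms(1)
\<comment> \<open>The inserted \<open>x\<close> has the largest \<open>r\<close>, so its rank is the
  full cardinality and it contributes the last term on the right. The ranks of the other elements
  can only grow.\<close>
proof (induction V rule: finite_ranking_induct[where f = r])
  case (insert x S)
  show ?case
  proof (cases "x \<in> S")
    case True
    thus ?thesis using insert by (simp add: insert_absorb)
  next
    case False
    have "{w\<in>insert x S. r w \<le> r x} = insert x S" using insert.hyps by auto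
    moreover have "F (card {w\<in>insert x S. r w \<le> r u}) \<le> F (card {w\<in>S. r w \<le> r u})" for u
      using insert.hyps by (intro antimonoD[OF F] card_mono) auto
    hence "(\<Sum>u\<in>S. F (card {w\<in>insert x S. r w \<le> r u})) \<le> (\<Sum>u\<in>S. F (card {w\<in>S. r w \<le> r u}))"
      by (intro sum_mono)
    ultimately show ?thesis using insert.IH insert.hyps False by simp
  qed
qed simp

text \<open>A right Riemann sum of the decreasing function \<open>n\<^sup>2 / (1 + x * t)\<close> on
  the unit interval stays below the integral. The comparison is done termwise with the increments of
  the antiderivative \<open>L\<close>, which telescope.\<close>

lemma sum_le_ln:
  fixes x :: real
  assumes x: "0 < x" and n: "0 < n"
  shows "(\<Sum>i<n. real n ^ 2 / (real n + x * real (Suc i))) \<le> real n ^ 2 * ln (1 + x) / x"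
proof -
  define L where "L i = ln (1 + x * real i / real n)" for i
  have "real n ^ 2 / (real n + x * real (Suc i)) \<le> real n ^ 2 / x * (L (Suc i) - L i)" for i
  proof -
    define p q where "p = 1 + x * real (Suc i) / real n" and "q = 1 + x * real i / real n"
    have pq: "p > 0" "q > 0" using x n by (auto simp: p_def q_def intro!: add_pos_nonneg)
    have "ln q - ln p = ln (q / p)" using pq by (simp add: ln_div)
    also have "\<dots> \<le> q / p - 1" using pq by (intro ln_le_minus_one) simp
    finally have "1 - q / p \<le> L (Suc i) - L i" by (simp add: L_def p_def q_def)
    moreover have "1 - q / p = (p - q) / p" using pq by (simp add: field_simps)
    moreover have "p - q = x / real n" by (simp add: p_def q_def algebra_simps add_divide_distrib)
    ultimately have "x / real n / p \<le> L (Suc i) - L i" by simp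
    hence "real n ^ 2 / x * (x / real n / p) \<le> real n ^ 2 / x * (L (Suc i) - L i)"
      using x by (intro mult_left_mono) auto
    moreover have "real n * p = real n + x * real (Suc i)"
      using n by (simp add: p_def field_simps)
    hence "real n ^ 2 / x * (x / real n / p) = real n ^ 2 / (real n + x * real (Suc i))"
      using x n pq by (simp add: power2_eq_square field_simps)
    ultimately show ?thesis by simp
  qed
  hence "(\<Sum>i<n. real n ^ 2 / (real n + x * real (Suc i))) \<le>
      (\<Sum>i<n. real n ^ 2 / x * (L (Suc i) - L i))"
    by (intro sum_mono)
  also have "\<dots> = real n ^ 2 / x * (L n - L 0)"
    by (simp only: sum_lessThan_telescope flip: sum_distrib_left)
  also have "\<dots> = real n ^ 2 * ln (1 + x) / x" using n by (simp add: L_def)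
  finally show ?thesis .
qed

text \<open>For fixed \<open>u\<close>, the point \<open>r u\<close> separates the intervals ending
  no later than \<open>u\<close> from those starting after it. So \<open>sep\<close> bounds the
  number of the latter through the rank of \<open>u\<close>.\<close>

lemma card_left_right_pairs_le:
  fixes l r :: "'a \<Rightarrow> real" and x :: real
  assumes "finite V" "V \<noteq> {}" "0 < x"
    and sep: "\<And>A B. A \<subseteq> V \<Longrightarrow> B \<subseteq> V \<Longrightarrow> (\<And>a b. a \<in> A \<Longrightarrow> b \<in> B \<Longrightarrow> r a < l b) \<Longrightarrow>
      x * real (card A) * real (card B) \<le> real (card V) * (real (card V) - real (card B))"
  shows "real (card {(u, v). u \<in> V \<and> v \<in> V \<and> r u < l v}) \<le> real (card V) ^ 2 * ln (1 + x) / x"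
proof -
  define n where "n = card V"
  have n: "n > 0" using assms by (simp add: n_def card_gt_0_iff)
  \<comment> \<open>This is \<open>x * i * b \<le> n * (n - b)\<close> solved for
    \<open>b\<close>.\<close>
  define F where "F i = real n ^ 2 / (real n + x * real i)" for i
  have "antimono F"
    unfolding F_def using assms(3) n
    by (intro antimonoI divide_left_mono mult_pos_pos) (auto intro!: add_pos_nonneg)
  have "real (card {v\<in>V. r u < l v}) \<le> F (card {w\<in>V. r w \<le> r u})" for u
  proof -
    define a b where "a = real (card {w\<in>V. r w \<le> r u})" and "b = real (card {v\<in>V. r u < l v})"
    have "x * a * b \<le> real n * (real n - b)"
      unfolding a_def b_def n_def by (rule sep) auto
    moreover have "0 < real n + x * a"
      using n assms(3) by (intro add_pos_nonneg) (auto simp: a_def)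
    ultimately have "b \<le> real n ^ 2 / (real n + x * a)"
      by (simp add: field_simps power2_eq_square)
    thus ?thesis by (simp add: F_def a_def b_def)
  qed
  moreover have "{(u, v). u \<in> V \<and> v \<in> V \<and> r u < l v} = (SIGMA u:V. {v\<in>V. r u < l v})" by auto
  ultimately have "real (card {(u, v). u \<in> V \<and> v \<in> V \<and> r u < l v}) \<le>
      (\<Sum>u\<in>V. F (card {w\<in>V. r w \<le> r u}))"
    using assms(1) by (simp add: sum_mono)
  also have "\<dots> \<le> (\<Sum>i<n. F (Suc i))" unfolding n_def by (rule sum_rank_le) fact+
  also have "\<dots> \<le> real n ^ 2 * ln (1 + x) / x"
    unfolding F_def using assms(3) n by (rule sum_le_ln)
  finally show ?thesis by (simp add: n_def)
qed

text \<open>Of two disjoint intervals one lies entirely to the left of the other. Non-edges are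
  counted as ordered pairs, whence the factor 2.\<close>

lemma card_interval_graph_nonedges_le:
  fixes H :: "'a pair_pre_digraph" and x :: real
  assumes H: "interval_graph H" and V: "pverts H = V" "finite V" "V \<noteq> {}" and x: "0 < x"
    and sep: "\<And>A B. A \<subseteq> V \<Longrightarrow> B \<subseteq> V \<Longrightarrow> parcs H \<inter> A \<times> B = {} \<Longrightarrow> A \<inter> B = {} \<Longrightarrow>
      x * real (card A) * real (card B) \<le> real (card V) * (real (card V) - real (card B))"
  shows "real (card {(u, v). u \<in> V \<and> v \<in> V \<and> u \<noteq> v \<and> (u, v) \<notin> parcs H}) \<le>
    2 * (real (card V) ^ 2 * ln (1 + x) / x)"
proof -
  obtain l r :: "'a \<Rightarrow> real" where lr: "\<And>v. v \<in> V \<Longrightarrow> l v \<le> r v"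
    and edge: "\<And>u v. u \<in> V \<Longrightarrow> v \<in> V \<Longrightarrow> u \<noteq> v \<Longrightarrow>
      (u, v) \<in> parcs H \<longleftrightarrow> {l u..r u} \<inter> {l v..r v} \<noteq> {}"
    using H V unfolding interval_graph_def by blast
  define P where "P = {(u, v). u \<in> V \<and> v \<in> V \<and> r u < l v}"
  have finP: "finite P"
    by (rule finite_subset[of _ "V \<times> V"]) (use V in \<open>auto simp: P_def\<close>)
  have "{(u, v). u \<in> V \<and> v \<in> V \<and> u \<noteq> v \<and> (u, v) \<notin> parcs H} \<subseteq> P \<union> prod.swap ` P"
  proof clarify
    fix u v assume uv: "u \<in> V" "v \<in> V" "u \<noteq> v" "(u, v) \<notin> parcs H" "(u, v) \<notin> prod.swap ` P"
    hence "(v, u) \<notin> P" by force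
    hence "l u \<le> r v" using uv by (simp add: P_def not_less)
    moreover have "{l u..r u} \<inter> {l v..r v} = {}" using edge uv by blast
    \<comment> \<open>If both inequalities held, the larger left endpoint would lie in both
      intervals.\<close>
    hence "\<not> (l u \<le> r v \<and> l v \<le> r u)"
      using lr[OF uv(1)] lr[OF uv(2)] by (auto dest!: equals0D[of _ "max (l u) (l v)"])
    ultimately show "(u, v) \<in> P" using uv by (simp add: P_def)
  qed
  hence "card {(u, v). u \<in> V \<and> v \<in> V \<and> u \<noteq> v \<and> (u, v) \<notin> parcs H} \<le> card (P \<union> prod.swap ` P)"
    using finP by (intro card_mono) auto
  also have "\<dots> \<le> card P + card (prod.swap ` P)" by (rule card_Un_le)
  also have "card (prod.swap ` P) = card P" by (intro card_image) auto
  finally have "real (card {(u, v). u \<in> V \<and> v \<in> V \<and> u \<noteq> v \<and> (u, v) \<notin> parcs H}) \<le> 2 * real (card P)"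
    by linarith
  moreover have "real (card P) \<le> real (card V) ^ 2 * ln (1 + x) / x"
    unfolding P_def
  proof (rule card_left_right_pairs_le[OF V(2,3) x])
    fix A B assume AB: "A \<subseteq> V" "B \<subseteq> V" "\<And>a b. a \<in> A \<Longrightarrow> b \<in> B \<Longrightarrow> r a < l b"
    \<comment> \<open>A common element would have \<open>r a < l a\<close>. Disjointness also
      matters because \<open>edge\<close> speaks only of distinct vertices.\<close>
    have "A \<inter> B = {}" using AB lr by force
    moreover have "(a, b) \<notin> parcs H" if "a \<in> A" "b \<in> B" for a b
    proof -
      have "a \<noteq> b" using that \<open>A \<inter> B = {}\<close> by auto
      moreover have "{l a..r a} \<inter> {l b..r b} = {}" using AB(3)[OF that] by auto
      ultimately show ?thesis using edge[of a b] AB that by blast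
    qed
    ultimately show "x * real (card A) * real (card B) \<le>
        real (card V) * (real (card V) - real (card B))"
      using AB by (intro sep) auto
  qed
  ultimately show ?thesis by linarith
qed

section \<open>The lower bound on the boxicity\<close>

text \<open>Connectedness is strong connectedness of the symmetric closure, which has the same
  reachability as the already symmetric \<open>G\<close>. A walk starting in \<open>S\<close> never
  leaves it.\<close>

lemma connected_imp_closed_set_eq_verts:
  assumes "pair_graph G" and conn: "Digraph_Component.connected (with_proj G)"
    and S: "S \<subseteq> pverts G" "S \<noteq> {}" "parcs G `` S \<subseteq> S"
  shows "S = pverts G"
proof -
  interpret pair_graph G by fact
  have sc: "strongly_connected (mk_symmetric (with_proj G))"
    using conn by (simp add: connected_def)
  obtain u where u: "u \<in> S" using S by blast
  have "v \<in> S" if "v \<in> pverts G" for v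
  proof -
    have "u \<rightarrow>\<^sup>*\<^bsub>mk_symmetric (with_proj G)\<^esub> v"
      using sc u that S unfolding strongly_connected_def by auto
    hence "u \<rightarrow>\<^sup>*\<^bsub>with_proj G\<^esub> v"
      using reachable_mk_symmetric_eq[OF sym_arcs] by simp
    thus ?thesis
    proof (induction rule: reachable_induct)
      case (step a b)
      thus ?case using S by auto
    qed (use u in auto)
  qed
  thus ?thesis using S by blast
qed

lemma pair_graph_connected_regular:
  assumes G: "pair_graph G" and conn: "Digraph_Component.connected (with_proj G)"
    and reg: "regular_graph k G"
  shows "connected_regular (pverts G) (parcs G) k"
proof -
  interpret pair_graph G by fact
  show ?thesis
  proof
    show "finite (pverts G)" by (rule pair_finite_verts)
    show "pverts G \<noteq> {}"
      using conn by (auto simp: connected_def strongly_connected_def)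
    show "parcs G \<subseteq> pverts G \<times> pverts G" using wellformed' by auto
    show "sym (parcs G)" using pair_sym_arcs by (simp add: symmetric_def)
    show "card (parcs G `` {v}) = k" if "v \<in> pverts G" for v
    proof -
      have "out_arcs (with_proj G) v = Pair v ` (parcs G `` {v})" by (auto simp: out_arcs_def)
      hence "card (parcs G `` {v}) = out_degree (with_proj G) v"
        by (simp add: out_degree_def card_image inj_on_def)
      thus ?thesis using reg that by (simp add: regular_graph_def)
    qed
    show "S = pverts G" if "S \<subseteq> pverts G" "S \<noteq> {}" "parcs G `` S \<subseteq> S" for S
      using connected_imp_closed_set_eq_verts[OF G conn that] .
  qed
qed

lemma pair_graph_irrefl: "pair_graph G \<Longrightarrow> (v, v) \<notin> parcs G"
  using pair_loopfree_digraph.pair_no_loops pair_graph.axioms pair_digraph.axioms by fastforce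

lemma card_nonedges:
  assumes "pair_graph G" and reg: "connected_regular (pverts G) (parcs G) k"
  shows "real (card {(u, v). u \<in> pverts G \<and> v \<in> pverts G \<and> u \<noteq> v \<and> (u, v) \<notin> parcs G}) =
    real (card (pverts G)) * (real (card (pverts G)) - real k - 1)"
proof -
  interpret pair_graph G by fact
  interpret R: connected_regular "pverts G" "parcs G" k by fact
  let ?V = "pverts G"
  have row: "real (card (?V - insert u (parcs G `` {u}))) = real (card ?V) - real k - 1"
    if u: "u \<in> ?V" for u
  proof -
    have "u \<notin> parcs G `` {u}" using pair_graph_irrefl[OF assms(1)] by auto
    hence "card (insert u (parcs G `` {u})) = k + 1"
      using R.card_neighbours[OF u] R.finite_neighbours by simp
    moreover have sub: "insert u (parcs G `` {u}) \<subseteq> ?V" using R.neighbours_subset u by auto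
    \<comment> \<open>This lets the truncated difference of cardinalities become a real
      difference.\<close>
    moreover have "card (insert u (parcs G `` {u})) \<le> card ?V"
      using sub pair_finite_verts by (intro card_mono)
    ultimately show ?thesis
      using R.finite_neighbours by (simp add: card_Diff_subset)
  qed
  have "{(u, v). u \<in> ?V \<and> v \<in> ?V \<and> u \<noteq> v \<and> (u, v) \<notin> parcs G} =
      (SIGMA u:?V. ?V - insert u (parcs G `` {u}))" by auto
  thus ?thesis using row pair_finite_verts by simp
qed

theorem theorem7:
  fixes G :: "'a pair_pre_digraph" and vs :: "'a list" and n k :: nat and \<mu> :: real
  assumes "pair_graph G"
    and "Digraph_Component.connected (with_proj G)"
    and "regular_graph k G"
    and "n = card (pverts G)"
    and "distinct vs" and "set vs = pverts G"
    and "second_largest_abs_eigenvalue (adjacency_matrix vs G) \<mu>"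
  shows "real (boxicity G) \<ge>
    ((real k ^ 2 / \<mu> ^ 2) / ln (real k ^ 2 / \<mu> ^ 2 + 1)) * ((real n - real k - 1) / (2 * real n))"
proof -
  define x where "x = real k ^ 2 / \<mu> ^ 2"
  show ?thesis
  \<comment> \<open>Since division by zero yields zero, this case contains \<open>\<mu> = 0\<close>
    as well as \<open>k = 0\<close>; the bound then reads \<open>0\<close>.\<close>
  proof (cases "x = 0")
    case True
    thus ?thesis by (simp flip: x_def)
  next
    case False
    hence x: "x > 0" and \<mu>: "\<mu> \<noteq> 0" by (auto simp: x_def zero_less_divide_iff)
    let ?V = "pverts G"
    have reg: "connected_regular ?V (parcs G) k"
      using pair_graph_connected_regular assms(1-3) .
    interpret connected_regular ?V "parcs G" k by fact
    have "k \<noteq> 0" using False by (auto simp: x_def)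
    \<comment> \<open>The extremal problem needs a nonzero function of sum zero, hence two vertices:
      here a vertex and one of its neighbours.\<close>
    have card2: "2 \<le> card ?V"
    proof -
      obtain v where v: "v \<in> ?V" using nonempty_V by blast
      have "v \<notin> parcs G `` {v}"
        using pair_graph_irrefl[OF assms(1)] by auto
      hence "insert v (parcs G `` {v}) \<subseteq> ?V \<and> card (insert v (parcs G `` {v})) = Suc k"
        using v card_neighbours[OF v] finite_neighbours[of v] neighbours_subset[of v] by auto
      hence "Suc k \<le> card ?V" using finite_V by (metis card_mono)
      thus ?thesis using \<open>k \<noteq> 0\<close> by simp
    qed
    define m where "m = boxicity G"
    have "\<exists>I. interval_representation G m I"
      unfolding m_def boxicity_def
      by (rule LeastI_ex) (rule interval_representation_exists[OF assms(1)])
    then obtain I where I: "interval_representation G m I" by blast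
    define NE where
      "NE H = {(u, v). u \<in> ?V \<and> v \<in> ?V \<and> u \<noteq> v \<and> (u, v) \<notin> parcs H}" for H :: "'a pair_pre_digraph"
    define M where "M = 2 * (real n ^ 2 * ln (1 + x) / x)"
    have n: "n > 0" using card2 assms(4) by simp
    have bound: "real (card (NE (I i))) \<le> M" if i: "i < m" for i
      unfolding M_def NE_def assms(4)
    proof (rule card_interval_graph_nonedges_le[OF _ _ finite_V nonempty_V x])
      show "interval_graph (I i)" "pverts (I i) = ?V"
        using I i by (auto simp: interval_representation_def)
      fix A B assume AB: "A \<subseteq> ?V" "B \<subseteq> ?V" "parcs (I i) \<inter> A \<times> B = {}"
      \<comment> \<open>Sets without edges between them in the supergraph have none in
        \<open>G\<close> either, so the spectral bound for \<open>G\<close> applies.\<close>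
      have "parcs G \<subseteq> parcs (I i)" using I i by (auto simp: interval_representation_def)
      hence "parcs G \<inter> A \<times> B = {}" using AB by blast
      hence "real k ^ 2 * real (card A) * real (card B) \<le>
          \<mu>\<^sup>2 * real (card ?V) * (real (card ?V) - real (card B))"
        using AB adj_norm_le_second_eigenvalue[OF assms(5,6) refl assms(7) card2]
        by (intro nonadjacent_sets_bound)
      thus "x * real (card A) * real (card B) \<le> real (card ?V) * (real (card ?V) - real (card B))"
        using \<mu> by (simp add: x_def field_simps)
    qed
    \<comment> \<open>\<open>G\<close> is the intersection of the \<open>I i\<close> inside the
      complete graph, so each of its non-edges is missing from some \<open>I i\<close>.\<close>
    have "NE G \<subseteq> (\<Union>i<m. NE (I i))"
      using I by (auto simp: NE_def interval_representation_def)
    moreover have fin: "finite (NE H)" for H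
      by (rule finite_subset[of _ "?V \<times> ?V"]) (use finite_V in \<open>auto simp: NE_def\<close>)
    ultimately have "card (NE G) \<le> card (\<Union>i<m. NE (I i))" by (intro card_mono) auto
    also have "\<dots> \<le> (\<Sum>i<m. card (NE (I i)))" by (rule card_UN_le) simp
    finally have "real (card (NE G)) \<le> (\<Sum>i<m. real (card (NE (I i))))"
      by (simp flip: of_nat_sum)
    also have "\<dots> \<le> (\<Sum>i<m. M)" using bound by (intro sum_mono) auto
    finally have "real n * (real n - real k - 1) \<le> real m * M"
      using card_nonedges[OF assms(1) reg] by (simp add: NE_def assms(4))
    also have "\<dots> = real n * (2 * real n * real m * ln (x + 1) / x)"
      by (simp add: M_def power2_eq_square algebra_simps)
    finally have "real n - real k - 1 \<le> 2 * real n * real m * ln (x + 1) / x"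
      by (rule mult_left_le_imp_le) (use n in simp)
    moreover have "ln (x + 1) > 0" using x by simp
    ultimately have "x / ln (x + 1) * ((real n - real k - 1) / (2 * real n)) \<le> real m"
      using x n by (simp add: field_simps)
    thus ?thesis by (simp add: x_def m_def)
  qed
qed

end
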